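(* Let $G$ be a finite graph whose vertex set is partitioned into $V_1 \sqcup V_2 \sqcup \dots \sqcup V_m$. Let $q$ be a prime power with $q > 2N(v) + N^2(v)$ for every vertex $v$ of $G$. If $|V_j| \ge 2q-1$ for all $j$, then there are $q$ pairwise disjoint independent sets $S_1, \dots, S_q$ of $G$ such that each $S_i$ intersects each $V_j$.
   Context: For a vertex $v$, $N(v)$ denotes the number of neighbors of $v$, and $N^2(v)$ the number of vertices at distance exactly two from $v$. A set of vertices is independent if it contains no two endpoints of an edge. *)

theory Defs
  imports
    "Graph_Theory.Graph_Theory"
    "HOL-Library.Disjoint_Sets"
    "HOL-Number_Theory.Prime_Powers"
begin

definition graph_dist :: "('a, 'b) pre_digraph \<Rightarrow> 'a \<Rightarrow> 'a \<Rightarrow> ereal" where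
  "graph_dist G u v = wf_digraph.\<mu> G (\<lambda>_. 1) u v"

definition num_neighbors :: "('a, 'b) pre_digraph \<Rightarrow> 'a \<Rightarrow> nat" where
  "num_neighbors G v = card {u \<in> verts G. v \<rightarrow>\<^bsub>G\<^esub> u}"

definition num_at_distance_two :: "('a, 'b) pre_digraph \<Rightarrow> 'a \<Rightarrow> nat" where
  "num_at_distance_two G v = card {u \<in> verts G. graph_dist G v u = 2}"

definition independent_set :: "('a, 'b) pre_digraph \<Rightarrow> 'a set \<Rightarrow> bool" where
  "independent_set G S \<longleftrightarrow> S \<subseteq> verts G \<and> (\<forall>u\<in>S. \<forall>v\<in>S. \<not> u \<rightarrow>\<^bsub>G\<^esub> v)"

end

theory Submission
  imports Defs
begin

text \<open>
  The hypothesis gives \<open>q > 2 N(v)\<close>, so Haxell's theorem applies: classes of size at least twice the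
  maximum degree have an independent transversal. After fewer than \<open>q\<close> transversals have been
  removed, every class still has at least \<open>q\<close> vertices, so \<open>q\<close> disjoint transversals can be chosen
  greedily.

  Haxell's theorem is proved by induction on the number of classes. Given an independent
  transversal \<open>t\<close> of all classes but \<open>a\<close>, one picks vertices \<open>x\<^sub>1, x\<^sub>2, \<dots>\<close>, each in class \<open>a\<close> or in the
  class of some \<open>t\<close>-neighbour of an earlier \<open>x\<^sub>l\<close>, and each not adjacent to the earlier \<open>x\<^sub>l\<close> and
  their \<open>t\<close>-neighbours. Choose \<open>t\<close> and the sequence so that the numbers of \<open>t\<close>-neighbours are
  lexicographically minimal. If some \<open>x\<^sub>i\<close> has no \<open>t\<close>-neighbour, then it either extends \<open>t\<close> to class
  \<open>a\<close>, or it can replace a \<open>t\<close>-neighbour of an earlier \<open>x\<^sub>l\<close>, contradicting minimality. Hence there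
  are at most as many \<open>x\<^sub>i\<close> as \<open>t\<close>-neighbours, together too few to dominate all the classes
  reached, and the sequence can be prolonged.
\<close>

section \<open>Partial transversals, search sequences and their rank\<close>

definition indep_transversal :: "('a \<Rightarrow> 'a \<Rightarrow> bool) \<Rightarrow> ('i \<Rightarrow> 'a set) \<Rightarrow> 'i set \<Rightarrow> ('i \<Rightarrow> 'a) \<Rightarrow> bool" where
  "indep_transversal E V I t \<longleftrightarrow>
     (\<forall>i\<in>I. t i \<in> V i) \<and> (\<forall>i\<in>I. \<forall>j\<in>I. \<not> E (t i) (t j))"

definition hit_classes :: "('a \<Rightarrow> 'a \<Rightarrow> bool) \<Rightarrow> 'i set \<Rightarrow> ('i \<Rightarrow> 'a) \<Rightarrow> 'a \<Rightarrow> 'i set" where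
  "hit_classes E I t x = {i\<in>I. E x (t i)}"

definition reached_classes :: "('a \<Rightarrow> 'a \<Rightarrow> bool) \<Rightarrow> 'i set \<Rightarrow> ('i \<Rightarrow> 'a) \<Rightarrow> 'a list \<Rightarrow> nat \<Rightarrow> 'i set" where
  "reached_classes E I t xs n = (\<Union>l<n. hit_classes E I t (xs ! l))"

text \<open>Disjointness of the hit sets encodes that \<open>xs ! i\<close> is not adjacent to the
  \<open>t\<close>-neighbours of earlier entries. The length bound lets all ranks have one common
  length; it exceeds \<open>card I\<close> by one, so that a sequence of up to \<open>card I\<close>
  entries can still be prolonged.\<close>

definition search_state ::
  "('a \<Rightarrow> 'a \<Rightarrow> bool) \<Rightarrow> ('i \<Rightarrow> 'a set) \<Rightarrow> 'i set \<Rightarrow> 'i \<Rightarrow> ('i \<Rightarrow> 'a) \<Rightarrow> 'a list \<Rightarrow> bool" where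
  "search_state E V I a t xs \<longleftrightarrow>
     indep_transversal E V I t \<and> length xs \<le> Suc (card I) \<and>
     (\<forall>i<length xs. (\<exists>j\<in>insert a (reached_classes E I t xs i). xs ! i \<in> V j) \<and>
        (\<forall>l<i. \<not> E (xs ! i) (xs ! l) \<and>
               hit_classes E I t (xs ! i) \<inter> hit_classes E I t (xs ! l) = {}))"

text \<open>Padding with a value exceeding every entry makes prolonging a sequence a lexicographic
  decrease, and keeps all lists the same length, so that the order is well-founded.\<close>

definition search_rank :: "('a \<Rightarrow> 'a \<Rightarrow> bool) \<Rightarrow> 'i set \<Rightarrow> ('i \<Rightarrow> 'a) \<Rightarrow> 'a list \<Rightarrow> nat list" where
  "search_rank E I t xs =
     map (\<lambda>x. card (hit_classes E I t x)) xs @ replicate (Suc (card I) - length xs) (Suc (card I))"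

lemma length_search_rank:
  "length xs \<le> Suc (card I) \<Longrightarrow> length (search_rank E I t xs) = Suc (card I)"
  by (simp add: search_rank_def)

lemma nth_search_rank:
  "i < length xs \<Longrightarrow> search_rank E I t xs ! i = card (hit_classes E I t (xs ! i))"
  by (simp add: search_rank_def nth_append)

lemma lex_less_thanI:
  assumes "length us = length vs" "p < length vs" "\<And>i. i < p \<Longrightarrow> us ! i = vs ! i" "us ! p < vs ! p"
  shows "(us, vs) \<in> lex less_than"
proof -
  have eq: "take p us = take p vs"
    using assms by (intro nth_equalityI) auto
  have u: "us = take p us @ us ! p # drop (Suc p) us"
    using assms by (intro id_take_nth_drop) simp
  have v: "vs = take p us @ vs ! p # drop (Suc p) vs"
    unfolding eq using assms by (intro id_take_nth_drop) simp
  show ?thesis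
    unfolding lex_conv using u v assms(1,4) by blast
qed

lemma finite_hit_classes: "finite I \<Longrightarrow> finite (hit_classes E I t x)"
  by (simp add: hit_classes_def)

lemma reached_classes_subset: "reached_classes E I t xs n \<subseteq> I"
  by (auto simp: reached_classes_def hit_classes_def)

text \<open>Serves two moves: for \<open>j\<close> outside \<open>I\<close> it extends the
  transversal to a new class, for \<open>j\<close> in \<open>I\<close> it exchanges the
  representative of class \<open>j\<close>.\<close>

lemma indep_transversal_upd:
  assumes "indep_transversal E V I t" "hit_classes E I t x = {}" "x \<in> V j"
    and "\<And>x y. E x y \<Longrightarrow> E y x" "\<And>x. \<not> E x x"
  shows "indep_transversal E V (insert j I) (t(j := x))"
proof -
  have "\<not> E x (t i)" "\<not> E (t i) x" if "i \<in> I" for i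
    using assms(2,4) that by (auto simp: hit_classes_def)
  then show ?thesis
    using assms(1,3,5) by (simp add: indep_transversal_def)
qed

section \<open>Moves that lower the rank\<close>

text \<open>The vertex \<open>xs ! i\<close> takes the place of \<open>t j\<close>, where
  \<open>j\<close> is hit by an earlier \<open>xs ! l\<close>. As \<open>xs ! i\<close> is adjacent
  to no earlier entry, \<open>xs ! l\<close> loses the hit \<open>j\<close> and gains none, while
  the entries before it keep their hits. So the rank drops at position \<open>l\<close>.\<close>

lemma search_state_swap:
  assumes st: "search_state E V I a t xs" and fin: "finite I"
    and sym: "\<And>x y. E x y \<Longrightarrow> E y x" and irr: "\<And>x. \<not> E x x"
    and i: "i < length xs" and empty: "hit_classes E I t (xs ! i) = {}"
    and j: "j \<in> reached_classes E I t xs i" "xs ! i \<in> V j"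
  shows "\<exists>t' xs'. search_state E V I a t' xs' \<and>
           (search_rank E I t' xs', search_rank E I t xs) \<in> lex less_than"
proof -
  obtain l where l: "l < i" "j \<in> hit_classes E I t (xs ! l)"
    using j by (auto simp: reached_classes_def)
  define t' where "t' = t(j := xs ! i)"
  \<comment> \<open>The entries after \<open>l\<close> are discarded: they may lie in class
    \<open>j\<close>, which need no longer be reached, and the rank comparison is already decided at
    \<open>l\<close>.\<close>
  define xs' where "xs' = take (Suc l) xs"
  have jI: "j \<in> I" using l by (simp add: hit_classes_def)
  have len: "length xs' = Suc l" using l i by (simp add: xs'_def)
  have nth: "xs' ! p = xs ! p" if "p \<le> l" for p
    using that by (simp add: xs'_def)
  have disj: "hit_classes E I t (xs ! u) \<inter> hit_classes E I t (xs ! v) = {}"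
    if "v < u" "u < length xs" for u v
    using st that by (simp add: search_state_def)
  have nadj: "\<not> E (xs ! p) (xs ! i)" if "p \<le> l" for p
  proof -
    have "\<not> E (xs ! i) (xs ! p)"
      using st that l i by (simp add: search_state_def)
    then show ?thesis using sym by blast
  qed
  have hit_rm: "hit_classes E I t' (xs ! p) = hit_classes E I t (xs ! p) - {j}" if "p \<le> l" for p
    using nadj[OF that] by (auto simp: hit_classes_def t'_def)
  \<comment> \<open>Since \<open>xs ! l\<close> hits \<open>j\<close>, disjointness of the hit sets
    keeps \<open>j\<close> out of those of earlier entries.\<close>
  have hit_lt: "hit_classes E I t' (xs ! p) = hit_classes E I t (xs ! p)" if "p < l" for p
    using hit_rm[of p] disj[of p l] that l i by auto
  have reach: "reached_classes E I t' xs' p = reached_classes E I t xs p" if "p \<le> l" for p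
    using that nth hit_lt by (auto simp: reached_classes_def)
  have tr: "indep_transversal E V I t'"
    using indep_transversal_upd[of E V I t "xs ! i" j] st empty j sym irr jI
    by (simp add: search_state_def t'_def insert_absorb)
  have "search_state E V I a t' xs'"
    unfolding search_state_def
  proof (intro conjI allI impI)
    show "length xs' \<le> Suc (card I)" using st by (auto simp: search_state_def xs'_def)
  next
    fix p assume p: "p < length xs'"
    then have "p \<le> l" "p < length xs" using len l i by auto
    then show "\<exists>k\<in>insert a (reached_classes E I t' xs' p). xs' ! p \<in> V k"
      using st reach nth by (simp add: search_state_def)
    fix r assume r: "r < p"
    show "\<not> E (xs' ! p) (xs' ! r)"
      using st r \<open>p \<le> l\<close> \<open>p < length xs\<close> nth by (simp add: search_state_def)
    show "hit_classes E I t' (xs' ! p) \<inter> hit_classes E I t' (xs' ! r) = {}"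
      using disj[of r p] r \<open>p \<le> l\<close> \<open>p < length xs\<close> nth hit_rm by auto
  qed (fact tr)
  moreover have "(search_rank E I t' xs', search_rank E I t xs) \<in> lex less_than"
  proof (rule lex_less_thanI)
    have bd: "length xs \<le> Suc (card I)" using st by (simp add: search_state_def)
    show "length (search_rank E I t' xs') = length (search_rank E I t xs)"
      using bd len l i by (simp add: length_search_rank)
    show "l < length (search_rank E I t xs)"
      using bd l i by (simp add: length_search_rank)
    show "search_rank E I t' xs' ! p = search_rank E I t xs ! p" if "p < l" for p
      using that len l i by (simp add: nth_search_rank nth hit_lt)
    have "card (hit_classes E I t (xs ! l) - {j}) < card (hit_classes E I t (xs ! l))"
      using l fin by (intro card_Diff1_less finite_hit_classes)
    then show "search_rank E I t' xs' ! l < search_rank E I t xs ! l"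
      using len l i by (simp add: nth_search_rank nth hit_rm)
  qed
  ultimately show ?thesis by blast
qed

text \<open>Since \<open>x\<close> is adjacent to no reached \<open>t i\<close>, its hit set is
  disjoint from all earlier ones.\<close>

lemma search_state_append:
  assumes st: "search_state E V I a t xs" and fin: "finite I" and len: "length xs \<le> card I"
    and sym: "\<And>x y. E x y \<Longrightarrow> E y x"
    and x: "j \<in> insert a (reached_classes E I t xs (length xs))" "x \<in> V j"
    and nxs: "\<And>i. i < length xs \<Longrightarrow> \<not> E (xs ! i) x"
    and nt: "\<And>i. i \<in> reached_classes E I t xs (length xs) \<Longrightarrow> \<not> E (t i) x"
  shows "search_state E V I a t (xs @ [x])"
    and "(search_rank E I t (xs @ [x]), search_rank E I t xs) \<in> lex less_than"
proof -
  let ?n = "length xs"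
  have reach: "reached_classes E I t (xs @ [x]) p = reached_classes E I t xs p" if "p \<le> ?n" for p
    using that by (auto simp: reached_classes_def nth_append)
  have disj: "hit_classes E I t x \<inter> hit_classes E I t (xs ! l) = {}" if "l < ?n" for l
    using nt that sym by (force simp: reached_classes_def hit_classes_def)
  show "search_state E V I a t (xs @ [x])"
    unfolding search_state_def
  proof (intro conjI allI impI)
    show "indep_transversal E V I t" using st by (simp add: search_state_def)
    show "length (xs @ [x]) \<le> Suc (card I)" using len by simp
  next
    fix p assume "p < length (xs @ [x])"
    then consider "p < ?n" | "p = ?n" by fastforce
    note p = this
    show "\<exists>k\<in>insert a (reached_classes E I t (xs @ [x]) p). (xs @ [x]) ! p \<in> V k"
      using p
    proof cases
      case 1 then show ?thesis using st reach[of p] by (simp add: search_state_def nth_append)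
    next
      case 2 then show ?thesis using x reach[of p] by auto
    qed
    fix r assume r: "r < p"
    show "\<not> E ((xs @ [x]) ! p) ((xs @ [x]) ! r)"
      using p
    proof cases
      case 1 then show ?thesis using st r by (simp add: search_state_def nth_append)
    next
      case 2 then show ?thesis using nxs[of r] sym r by (auto simp: nth_append)
    qed
    show "hit_classes E I t ((xs @ [x]) ! p) \<inter> hit_classes E I t ((xs @ [x]) ! r) = {}"
      using p
    proof cases
      case 1 then show ?thesis using st r by (simp add: search_state_def nth_append)
    next
      case 2 then show ?thesis using disj[of r] r by (simp add: nth_append)
    qed
  qed
  show "(search_rank E I t (xs @ [x]), search_rank E I t xs) \<in> lex less_than"
  proof (rule lex_less_thanI)
    show "length (search_rank E I t (xs @ [x])) = length (search_rank E I t xs)"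
      "?n < length (search_rank E I t xs)"
      using len by (simp_all add: length_search_rank)
    show "search_rank E I t (xs @ [x]) ! p = search_rank E I t xs ! p" if "p < ?n" for p
      using that by (simp add: search_rank_def nth_append)
    \<comment> \<open>Hits lie in \<open>I\<close>, so the new entry stays below the padding value
      \<open>Suc (card I)\<close> that it replaces.\<close>
    have "card (hit_classes E I t x) \<le> card I"
      using fin by (intro card_mono) (auto simp: hit_classes_def)
    then show "search_rank E I t (xs @ [x]) ! ?n < search_rank E I t xs ! ?n"
      using len by (simp add: search_rank_def nth_append)
  qed
qed

section \<open>Counting dominated vertices\<close>

text \<open>The reached classes form a disjoint union of nonempty hit sets, one for each entry of
  \<open>xs\<close>.\<close>

lemma card_reached_classes_ge:
  assumes st: "search_state E V I a t xs" and fin: "finite I"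
    and ne: "\<And>i. i < length xs \<Longrightarrow> hit_classes E I t (xs ! i) \<noteq> {}"
  shows "length xs \<le> card (reached_classes E I t xs (length xs))"
proof -
  have disj: "hit_classes E I t (xs ! u) \<inter> hit_classes E I t (xs ! v) = {}"
    if "u \<noteq> v" "u < length xs" "v < length xs" for u v
    using st that unfolding search_state_def by (metis inf_commute nat_neq_iff)
  have "length xs = (\<Sum>l<length xs. 1)" by simp
  also have "\<dots> \<le> (\<Sum>l<length xs. card (hit_classes E I t (xs ! l)))"
    using ne fin by (intro sum_mono) (simp add: Suc_le_eq card_gt_0_iff finite_hit_classes)
  also have "\<dots> = card (reached_classes E I t xs (length xs))"
    unfolding reached_classes_def using disj fin
    by (intro card_UN_disjoint[symmetric]) (auto simp: finite_hit_classes)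
  finally show ?thesis .
qed

lemma card_UN_le_mult:
  assumes "finite A" "\<And>x. x \<in> A \<Longrightarrow> card (f x) \<le> d"
  shows "card (\<Union>x\<in>A. f x) \<le> card A * d"
proof -
  have "card (\<Union>x\<in>A. f x) \<le> (\<Sum>x\<in>A. card (f x))" using assms(1) by (rule card_UN_le)
  also have "\<dots> \<le> card A * d" using sum_bounded_above[of A "\<lambda>x. card (f x)" d] assms by simp
  finally show ?thesis .
qed

text \<open>With \<open>R\<close> the set of reached classes, there are at most
  \<open>card R\<close> entries in \<open>xs\<close> and \<open>card R\<close> representatives
  \<open>t i\<close>. Together they dominate at most \<open>2 * d * card R\<close> vertices, fewer
  than the classes in \<open>insert a R\<close> contain.\<close>

lemma exists_undominated_vertex:
  assumes st: "search_state E V I a t xs" and fin: "finite I" and a: "a \<notin> I"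
    and ne: "\<And>i. i < length xs \<Longrightarrow> hit_classes E I t (xs ! i) \<noteq> {}"
    and disj: "disjoint_family_on V (insert a I)"
    and finV: "\<And>i. i \<in> insert a I \<Longrightarrow> finite (V i)"
    and deg: "\<And>x. x \<in> (\<Union>i\<in>insert a I. V i) \<Longrightarrow> card {y \<in> (\<Union>i\<in>insert a I. V i). E x y} \<le> d"
    and size: "\<And>i. i \<in> I \<Longrightarrow> 2 * d \<le> card (V i)" and Va: "V a \<noteq> {}"
  shows "\<exists>j x. j \<in> insert a (reached_classes E I t xs (length xs)) \<and> x \<in> V j \<and>
           (\<forall>i<length xs. \<not> E (xs ! i) x) \<and>
           (\<forall>i\<in>reached_classes E I t xs (length xs). \<not> E (t i) x)"
proof -
  define R where "R = reached_classes E I t xs (length xs)"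
  define nb where "nb x = {y \<in> (\<Union>i\<in>insert a I. V i). E x y}" for x
  define D where "D = (\<Union>i<length xs. nb (xs ! i)) \<union> (\<Union>i\<in>R. nb (t i))"
  have RI: "R \<subseteq> I" by (simp add: R_def reached_classes_subset)
  then have finR: "finite R" using fin finite_subset by blast
  have "xs ! i \<in> (\<Union>i\<in>insert a I. V i)" if i: "i < length xs" for i
  proof -
    have "\<exists>j\<in>insert a (reached_classes E I t xs i). xs ! i \<in> V j"
      using st i by (simp add: search_state_def)
    then show ?thesis using reached_classes_subset[of E I t xs i] by blast
  qed
  then have 1: "card (\<Union>i<length xs. nb (xs ! i)) \<le> length xs * d"
    using card_UN_le_mult[of "{..<length xs}" "\<lambda>i. nb (xs ! i)" d] deg by (simp add: nb_def)
  have "t i \<in> (\<Union>i\<in>insert a I. V i)" if "i \<in> R" for i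
    using st that RI unfolding search_state_def indep_transversal_def by blast
  then have 2: "card (\<Union>i\<in>R. nb (t i)) \<le> card R * d"
    using finR deg by (intro card_UN_le_mult) (simp_all add: nb_def)
  have "length xs * d \<le> card R * d"
    using card_reached_classes_ge[OF st fin ne] by (simp add: R_def)
  with 1 2 have cD: "card D \<le> card R * (2 * d)"
    using card_Un_le[of "\<Union>i<length xs. nb (xs ! i)" "\<Union>i\<in>R. nb (t i)"]
    unfolding D_def mult_2 distrib_left by linarith
  have "card R * (2 * d) \<le> (\<Sum>i\<in>R. card (V i))"
    using sum_bounded_below[of R "2 * d" "\<lambda>i. card (V i)"] size RI by auto
  \<comment> \<open>Non-emptiness of \<open>V a\<close> makes the inequality strict.\<close>
  also have "\<dots> < card (V a) + (\<Sum>i\<in>R. card (V i))"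
    using Va finV[of a] by (simp add: card_gt_0_iff)
  also have "\<dots> = (\<Sum>i\<in>insert a R. card (V i))"
    using a RI finR by (subst sum.insert) auto
  also have "\<dots> = card (\<Union>i\<in>insert a R. V i)"
    using disj RI finR finV
    by (intro card_UN_disjoint[symmetric]) (auto simp: disjoint_family_on_def subset_iff)
  finally have "card D < card (\<Union>i\<in>insert a R. V i)" using cD by linarith
  moreover have "finite D"
  proof -
    have "D \<subseteq> (\<Union>i\<in>insert a I. V i)" by (auto simp: D_def nb_def)
    then show ?thesis using fin finV by (meson finite_UN finite_insert finite_subset)
  qed
  ultimately have "\<not> (\<Union>i\<in>insert a R. V i) \<subseteq> D"
    by (meson card_mono leD)
  then obtain x j where x: "x \<notin> D" "j \<in> insert a R" "x \<in> V j" by blast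
  then have "x \<in> (\<Union>i\<in>insert a I. V i)" using RI by blast
  then have "\<forall>i<length xs. \<not> E (xs ! i) x" "\<forall>i\<in>R. \<not> E (t i) x"
    using x by (auto simp: D_def nb_def)
  then show ?thesis using x unfolding R_def by blast
qed

section \<open>Haxell's theorem\<close>

lemma indep_transversal_extend:
  assumes tr: "indep_transversal E V I t" and fin: "finite I" and a: "a \<notin> I"
    and sym: "\<And>x y. E x y \<Longrightarrow> E y x" and irr: "\<And>x. \<not> E x x"
    and disj: "disjoint_family_on V (insert a I)"
    and finV: "\<And>i. i \<in> insert a I \<Longrightarrow> finite (V i)"
    and deg: "\<And>x. x \<in> (\<Union>i\<in>insert a I. V i) \<Longrightarrow> card {y \<in> (\<Union>i\<in>insert a I. V i). E x y} \<le> d"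
    and size: "\<And>i. i \<in> I \<Longrightarrow> 2 * d \<le> card (V i)" and Va: "V a \<noteq> {}"
  shows "\<exists>t'. indep_transversal E V (insert a I) t'"
proof (rule ccontr)
  assume no: "\<not> ?thesis"
  \<comment> \<open>The minimum is taken over transversal and sequence jointly, because a swap
    changes both.\<close>
  let ?r = "inv_image (lex less_than) (\<lambda>(t, xs). search_rank E I t xs)"
  have "wf ?r" by (intro wf_inv_image wf_lex wf_less_than)
  moreover have "(t, []) \<in> {(t, xs). search_state E V I a t xs}"
    using tr by (simp add: search_state_def)
  ultimately obtain s where s: "s \<in> {(t, xs). search_state E V I a t xs}"
    and min: "\<And>s'. (s', s) \<in> ?r \<Longrightarrow> s' \<notin> {(t, xs). search_state E V I a t xs}"
    by (rule wfE_min) blast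
  obtain u xs where s_eq: "s = (u, xs)" by (cases s)
  have st: "search_state E V I a u xs" using s s_eq by simp
  have min': "\<not> search_state E V I a t' xs'"
    if "(search_rank E I t' xs', search_rank E I u xs) \<in> lex less_than" for t' xs'
    using min[of "(t', xs')"] that s_eq by simp
  have ne: "hit_classes E I u (xs ! i) \<noteq> {}" if i: "i < length xs" for i
  proof
    assume empty: "hit_classes E I u (xs ! i) = {}"
    obtain j where j: "j \<in> insert a (reached_classes E I u xs i)" "xs ! i \<in> V j"
      using st i unfolding search_state_def by blast
    show False
    \<comment> \<open>An entry without hits in class \<open>a\<close> would extend \<open>u\<close>;
      in a reached class it allows a swap.\<close>
    proof (cases "j = a")
      case True
      then have "indep_transversal E V (insert a I) (u(a := xs ! i))"
        using indep_transversal_upd[of E V I u "xs ! i" a] st empty j sym irr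
        by (simp add: search_state_def)
      then show False using no by blast
    next
      case False
      then show False
        using search_state_swap[OF st fin sym irr i empty, of j] j min' by blast
    qed
  qed
  \<comment> \<open>This leaves room for one more entry, and prolonging contradicts
    minimality.\<close>
  have "length xs \<le> card I"
    using card_reached_classes_ge[OF st fin ne] card_mono[OF fin reached_classes_subset]
    by (meson le_trans)
  moreover obtain j x where "j \<in> insert a (reached_classes E I u xs (length xs))" "x \<in> V j"
    "\<And>i. i < length xs \<Longrightarrow> \<not> E (xs ! i) x"
    "\<And>i. i \<in> reached_classes E I u xs (length xs) \<Longrightarrow> \<not> E (u i) x"
    using exists_undominated_vertex[OF st fin a ne disj finV deg size Va] by blast
  ultimately show False
    using search_state_append[OF st fin _ sym] min' by metis
qed

text \<open>Induction on the set of classes: degrees can only fall in a subfamily. Non-emptiness is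
  a separate hypothesis because the size bound is vacuous for \<open>d = 0\<close>.\<close>

theorem haxell_indep_transversal:
  assumes "finite I"
    and sym: "\<And>x y. E x y \<Longrightarrow> E y x" and irr: "\<And>x. \<not> E x x"
    and "disjoint_family_on V I"
    and "\<And>i. i \<in> I \<Longrightarrow> finite (V i)"
    and "\<And>x. x \<in> (\<Union>i\<in>I. V i) \<Longrightarrow> card {y \<in> (\<Union>i\<in>I. V i). E x y} \<le> d"
    and "\<And>i. i \<in> I \<Longrightarrow> 2 * d \<le> card (V i)" and "\<And>i. i \<in> I \<Longrightarrow> V i \<noteq> {}"
  shows "\<exists>t. indep_transversal E V I t"
  using assms(1,4-)
proof (induction I rule: finite_induct)
  case empty
  then show ?case by (simp add: indep_transversal_def)
next
  case (insert a I)
  have "\<exists>t. indep_transversal E V I t"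
  proof (rule insert.IH)
    show "disjoint_family_on V I"
      using insert.prems(1) by (rule disjoint_family_on_mono[rotated]) auto
    fix x assume x: "x \<in> (\<Union>i\<in>I. V i)"
    have "card {y \<in> (\<Union>i\<in>I. V i). E x y} \<le> card {y \<in> (\<Union>i\<in>insert a I. V i). E x y}"
      using insert.hyps insert.prems(2) by (intro card_mono) auto
    also have "\<dots> \<le> d" using insert.prems(3) x by blast
    finally show "card {y \<in> (\<Union>i\<in>I. V i). E x y} \<le> d" .
  qed (use insert.prems in auto)
  then obtain t where t: "indep_transversal E V I t" by blast
  show ?case
    by (rule indep_transversal_extend[OF t insert.hyps sym irr insert.prems(1-3)])
       (use insert.prems(4,5) in auto)
qed

section \<open>Disjoint transversals by greedy removal\<close>

text \<open>Each transversal uses one vertex per class, so the sizes suffice for \<open>n\<close>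
  rounds. As the classes are disjoint, injectivity within each class expresses that the transversals
  are disjoint.\<close>

lemma disjoint_indep_transversals:
  assumes "finite I"
    and sym: "\<And>x y. E x y \<Longrightarrow> E y x" and irr: "\<And>x. \<not> E x x"
    and disj: "disjoint_family_on V I"
    and finV: "\<And>i. i \<in> I \<Longrightarrow> finite (V i)"
    and deg: "\<And>x. x \<in> (\<Union>i\<in>I. V i) \<Longrightarrow> card {y \<in> (\<Union>i\<in>I. V i). E x y} \<le> d"
    and size: "\<And>i. i \<in> I \<Longrightarrow> 2 * d + n \<le> card (V i)"
  shows "\<exists>t. (\<forall>k<n. indep_transversal E V I (t k)) \<and> (\<forall>i\<in>I. inj_on (\<lambda>k. t k i) {..<n})"
  using size
proof (induction n)
  case 0
  then show ?case by simp
next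
  case (Suc n)
  have "\<exists>t. (\<forall>k<n. indep_transversal E V I (t k)) \<and> (\<forall>i\<in>I. inj_on (\<lambda>k. t k i) {..<n})"
    using Suc.prems by (intro Suc.IH) fastforce+
  then obtain t where t: "\<And>k. k < n \<Longrightarrow> indep_transversal E V I (t k)"
    "\<And>i. i \<in> I \<Longrightarrow> inj_on (\<lambda>k. t k i) {..<n}" by blast
  define W where "W i = V i - (\<lambda>k. t k i) ` {..<n}" for i
  have card_W: "card (V i) \<le> card (W i) + n" if "i \<in> I" for i
  proof -
    have "card (V i) - card ((\<lambda>k. t k i) ` {..<n}) \<le> card (W i)"
      unfolding W_def by (intro diff_card_le_card_Diff) simp
    moreover have "card ((\<lambda>k. t k i) ` {..<n}) \<le> n"
      using card_image_le[of "{..<n}" "\<lambda>k. t k i"] by simp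
    ultimately show ?thesis by linarith
  qed
  have "\<exists>s. indep_transversal E W I s"
  proof (rule haxell_indep_transversal[OF assms(1) sym irr])
    show "disjoint_family_on W I"
      using disj by (fastforce simp: disjoint_family_on_def W_def)
    show "finite (W i)" if "i \<in> I" for i using finV that by (simp add: W_def)
    show "2 * d \<le> card (W i)" if "i \<in> I" for i
      using card_W[OF that] Suc.prems[OF that] by linarith
    \<comment> \<open>After \<open>n\<close> removals from at least \<open>2 * d + Suc n\<close>
      vertices, \<open>2 * d + 1\<close> remain, so the class is nonempty even for
      \<open>d = 0\<close>.\<close>
    show "W i \<noteq> {}" if "i \<in> I" for i
    proof
      assume "W i = {}"
      then show False using card_W[OF that] Suc.prems[OF that] by simp
    qed
    fix x assume x: "x \<in> (\<Union>i\<in>I. W i)"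
    have "card {y \<in> (\<Union>i\<in>I. W i). E x y} \<le> card {y \<in> (\<Union>i\<in>I. V i). E x y}"
      using assms(1) finV by (intro card_mono) (auto simp: W_def)
    also have "\<dots> \<le> d" using deg x by (auto simp: W_def)
    finally show "card {y \<in> (\<Union>i\<in>I. W i). E x y} \<le> d" .
  qed
  then obtain s where s: "indep_transversal E W I s" by blast
  have sV: "indep_transversal E V I s"
    using s by (auto simp: indep_transversal_def W_def)
  have "s i \<notin> (\<lambda>k. t k i) ` {..<n}" if "i \<in> I" for i
    using s that by (auto simp: indep_transversal_def W_def)
  then have "inj_on (\<lambda>k. (t(n := s)) k i) {..<Suc n}" if "i \<in> I" for i
  proof -
    have "inj_on (\<lambda>k. (t(n := s)) k i) {..<n}"
      using t(2)[OF that] by (simp add: inj_on_def)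
    moreover have "s i \<notin> (\<lambda>k. (t(n := s)) k i) ` {..<n}"
      using \<open>\<And>i. i \<in> I \<Longrightarrow> s i \<notin> (\<lambda>k. t k i) ` {..<n}\<close>[OF that] by auto
    ultimately show ?thesis
      by (simp add: lessThan_Suc)
  qed
  moreover have "indep_transversal E V I ((t(n := s)) k)" if "k < Suc n" for k
    using t(1) sV that by (auto simp: less_Suc_eq)
  ultimately show ?case by blast
qed

section \<open>Application to the partitioned graph\<close>

theorem theorem5p5:
  fixes G :: "('a, 'b) pre_digraph" and V :: "nat \<Rightarrow> 'a set" and m q :: nat
  assumes "graph G"
    and "(\<Union>j\<in>{1..m}. V j) = verts G"
    and "disjoint_family_on V {1..m}"
    and "primepow q"
    and "\<forall>v\<in>verts G. q > 2 * num_neighbors G v + num_at_distance_two G v"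
    and "\<forall>j\<in>{1..m}. card (V j) \<ge> 2 * q - 1"
  shows "\<exists>S :: nat \<Rightarrow> 'a set.
           disjoint_family_on S {1..q} \<and>
           (\<forall>i\<in>{1..q}. independent_set G (S i)) \<and>
           (\<forall>i\<in>{1..q}. \<forall>j\<in>{1..m}. S i \<inter> V j \<noteq> {})"
proof -
  interpret graph G by fact
  let ?E = "\<lambda>u v. u \<rightarrow>\<^bsub>G\<^esub> v"
  have "\<exists>t. (\<forall>k<q. indep_transversal ?E V {1..m} (t k)) \<and>
            (\<forall>i\<in>{1..m}. inj_on (\<lambda>k. t k i) {..<q})"
  \<comment> \<open>This is the largest \<open>d\<close> with \<open>2 * d < q\<close>: it bounds
    all degrees, and \<open>2 * d + q \<le> 2 * q - 1\<close>.\<close>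
  proof (rule disjoint_indep_transversals[where d = "(q - 1) div 2"])
    show "?E y x" if "?E x y" for x y using that sym_arcs by (auto simp: symmetric_def dest: symD)
    show "\<not> ?E x x" for x using adj_not_same by blast
    show "disjoint_family_on V {1..m}" by fact
    show "finite (V i)" if "i \<in> {1..m}" for i
      using assms(2) that finite_verts by (metis UN_upper finite_subset)
    show "2 * ((q - 1) div 2) + q \<le> card (V i)" if "i \<in> {1..m}" for i
      using assms(6) that by force
    fix x assume "x \<in> (\<Union>i\<in>{1..m}. V i)"
    then have "2 * num_neighbors G x < q" using assms(2,5) by force
    then show "card {y \<in> (\<Union>i\<in>{1..m}. V i). ?E x y} \<le> (q - 1) div 2"
      unfolding assms(2) num_neighbors_def by linarith
  qed simp
  then obtain t where t: "\<And>k. k < q \<Longrightarrow> indep_transversal ?E V {1..m} (t k)"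
    and inj: "\<And>j. j \<in> {1..m} \<Longrightarrow> inj_on (\<lambda>k. t k j) {..<q}" by blast
  have tV: "t k j \<in> V j" if "k < q" "j \<in> {1..m}" for k j
    using t that by (auto simp: indep_transversal_def)
  \<comment> \<open>The shift matches the indices \<open>1..q\<close> of \<open>S\<close> with the
    indices below \<open>q\<close> of \<open>t\<close>.\<close>
  define S where "S i = t (i - 1) ` {1..m}" for i
  have "S i \<inter> S k = {}" if ik: "i \<in> {1..q}" "k \<in> {1..q}" "i \<noteq> k" for i k
  proof (rule ccontr)
    assume "S i \<inter> S k \<noteq> {}"
    then obtain j l where jl: "j \<in> {1..m}" "l \<in> {1..m}" "t (i - 1) j = t (k - 1) l"
      unfolding S_def by blast
    have lt: "i - 1 < q" "k - 1 < q" "i - 1 \<noteq> k - 1" using ik by auto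
    have "t (i - 1) j \<in> V j \<inter> V l"
      using tV[OF lt(1) jl(1)] tV[OF lt(2) jl(2)] jl(3) by simp
    \<comment> \<open>A shared vertex lies in a single class, so injectivity in that class
      applies.\<close>
    then have "j = l"
      using assms(3) jl(1,2) unfolding disjoint_family_on_def by blast
    then show False using inj[OF jl(1)] jl(3) lt by (auto simp: inj_on_def)
  qed
  then have "disjoint_family_on S {1..q}" by (simp add: disjoint_family_on_def)
  moreover have "independent_set G (S i)" if "i \<in> {1..q}" for i
  proof -
    have "i - 1 < q" using that by auto
    then show ?thesis
      using t[of "i - 1"] unfolding independent_set_def indep_transversal_def S_def assms(2)[symmetric]
      by blast
  qed
  moreover have "S i \<inter> V j \<noteq> {}" if "i \<in> {1..q}" "j \<in> {1..m}" for i j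
  proof -
    have "i - 1 < q" using that by auto
    then show ?thesis using tV[of "i - 1" j] that unfolding S_def by blast
  qed
  ultimately show ?thesis by blast
qed

end
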